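(* For all ultrafilters $\mathcal{U},\mathcal{V}$ on $\mathbb{N}$, if $\mathcal{U}\leq_{fe}\mathcal{V}\leq_{fe}\mathcal{U}\oplus1$, then $\mathcal{U}\equiv_{fe}\mathcal{V}$ or $\mathcal{U}\oplus1\equiv_{fe}\mathcal{V}$.
   Context: $\mathbb{N}=\{0,1,2,\dots\}$. For $A,B\subseteq\mathbb{N}$, $A\leq_{fe}B$ means that for every finite $F\subseteq A$ there is $k\in\mathbb{N}$ with $F+k\subseteq B$. For ultrafilters, $\mathcal{U}\leq_{fe}\mathcal{V}$ means that for every $B\in\mathcal{V}$ there is $A\in\mathcal{U}$ with $A\leq_{fe}B$; $\mathcal{U}\equiv_{fe}\mathcal{V}$ means $\mathcal{U}\leq_{fe}\mathcal{V}$ and $\mathcal{V}\leq_{fe}\mathcal{U}$. $\mathcal{U}\oplus1$ is the ultrafilter $\{A+1\mid A\in\mathcal{U}\}$ generates, i.e., $B\in\mathcal{U}\oplus1$ iff $\{n\mid n+1\in B\}\in\mathcal{U}$. *)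

theory Defs
  imports Main
begin

text \<open>
  An ultrafilter is a value of the library type of filters, so \<open>A \<in> \<U>\<close> is rendered
  as \<^term>\<open>eventually (\<lambda>n. n \<in> A) U\<close>. The library type includes the improper filter
  \<^term>\<open>bot\<close>, which is excluded explicitly; principal ultrafilters are included.
\<close>

definition ultrafilter :: "'a filter \<Rightarrow> bool" where
  "ultrafilter U \<longleftrightarrow>
     U \<noteq> bot \<and> (\<forall>A. eventually (\<lambda>x. x \<in> A) U \<or> eventually (\<lambda>x. x \<in> - A) U)"

definition fe_set :: "nat set \<Rightarrow> nat set \<Rightarrow> bool" where
  "fe_set A B \<longleftrightarrow> (\<forall>F. finite F \<and> F \<subseteq> A \<longrightarrow> (\<exists>k. (\<lambda>n. n + k) ` F \<subseteq> B))"

definition fe_le :: "nat filter \<Rightarrow> nat filter \<Rightarrow> bool" where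
  "fe_le U V \<longleftrightarrow>
     (\<forall>B. eventually (\<lambda>n. n \<in> B) V \<longrightarrow> (\<exists>A. eventually (\<lambda>n. n \<in> A) U \<and> fe_set A B))"

definition fe_equiv :: "nat filter \<Rightarrow> nat filter \<Rightarrow> bool" where
  "fe_equiv U V \<longleftrightarrow> fe_le U V \<and> fe_le V U"

definition oplus_one :: "nat filter \<Rightarrow> nat filter" where
  "oplus_one U = filtermap (\<lambda>n. n + 1) U"

lemma eventually_oplus_one_iff:
  "eventually (\<lambda>n. n \<in> B) (oplus_one U) \<longleftrightarrow> eventually (\<lambda>n. n \<in> {n. n + 1 \<in> B}) U"
  by (simp add: oplus_one_def eventually_filtermap)

lemma ultrafilter_oplus_one:
  assumes "ultrafilter U"
  shows "ultrafilter (oplus_one U)"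
proof -
  have "eventually (\<lambda>n. n \<in> B) (oplus_one U) \<or> eventually (\<lambda>n. n \<in> - B) (oplus_one U)" for B
  proof -
    have "- {n. n + 1 \<in> B} = {n. n + 1 \<in> - B}" by auto
    then show ?thesis
      using assms unfolding ultrafilter_def eventually_oplus_one_iff by metis
  qed
  moreover have "oplus_one U \<noteq> bot"
    using assms by (simp add: oplus_one_def ultrafilter_def filtermap_bot_iff)
  ultimately show ?thesis by (simp add: ultrafilter_def)
qed

end

theory Submission
  imports Defs
begin

text \<open>
  If some \<open>C \<in> V\<close> lies outside \<open>U\<close>, then each \<open>B \<in> V\<close> may be shrunk to a member of \<open>V\<close>
  outside \<open>U\<close>, and a set \<open>A \<in> U\<close> embedded in it may be taken disjoint from it. The shifts
  of nonempty finite subsets of \<open>A\<close> are then nonzero, so already \<open>A + 1\<close> is embedded.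
\<close>

lemma fe_set_subset: "A \<subseteq> B \<Longrightarrow> fe_set A B"
  unfolding fe_set_def by (intro allI impI exI[of _ 0]) auto

lemma fe_set_antimono_left: "fe_set A B \<Longrightarrow> A' \<subseteq> A \<Longrightarrow> fe_set A' B"
  unfolding fe_set_def by (meson order_trans)

lemma fe_set_mono_right: "fe_set A B \<Longrightarrow> B \<subseteq> B' \<Longrightarrow> fe_set A B'"
  unfolding fe_set_def by (meson order_trans)

text \<open>A shift of \<open>G\<close> by \<open>k > 0\<close> is a shift of its successor image by
  \<open>k - 1\<close>, so only \<open>k = 0\<close> could cause trouble.\<close>

lemma fe_set_Suc_image_if_disjoint:
  assumes "fe_set A B" and "A \<inter> B = {}"
  shows "fe_set (Suc ` A) B"
  unfolding fe_set_def
proof (intro allI impI)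
  fix F assume F: "finite F \<and> F \<subseteq> Suc ` A"
  then obtain G where G: "finite G" "G \<subseteq> A" "F = Suc ` G"
    using finite_subset_image[of F Suc A] by auto
  then obtain k where k: "(\<lambda>n. n + k) ` G \<subseteq> B"
    using assms(1) unfolding fe_set_def by blast
  show "\<exists>k. (\<lambda>n. n + k) ` F \<subseteq> B"
  proof (cases k)
    case 0
    \<comment> \<open>With shift 0, \<open>G\<close> itself lies in both \<open>A\<close> and
      \<open>B\<close>, so disjointness leaves only the empty set.\<close>
    then have "G = {}" using k G(2) assms(2) by auto
    then show ?thesis using G(3) by simp
  next
    case (Suc j)
    then have "(\<lambda>n. n + j) ` F \<subseteq> B" using k G(3) by auto
    then show ?thesis ..
  qed
qed

lemma ultrafilter_eventually_Compl_iff: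
  assumes "ultrafilter U"
  shows "eventually (\<lambda>x. x \<in> - A) U \<longleftrightarrow> \<not> eventually (\<lambda>x. x \<in> A) U"
proof
  assume *: "eventually (\<lambda>x. x \<in> - A) U"
  show "\<not> eventually (\<lambda>x. x \<in> A) U"
  proof
    assume "eventually (\<lambda>x. x \<in> A) U"
    from eventually_conj[OF * this] have "eventually (\<lambda>x. False) U" by simp
    then show False
      using assms by (simp add: ultrafilter_def trivial_limit_def)
  qed
qed (use assms in \<open>auto simp: ultrafilter_def\<close>)

text \<open>Maximality of ultrafilters: passing to complements reverses the inclusion, so each
  \<open>B\<close> in \<open>U\<close> already lies in \<open>V\<close> and embeds in itself with
  shift 0.\<close>

lemma fe_le_if_sets_subset:
  assumes "ultrafilter U" "ultrafilter V"
    and "\<And>C. eventually (\<lambda>n. n \<in> C) V \<Longrightarrow> eventually (\<lambda>n. n \<in> C) U"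
  shows "fe_le V U"
  unfolding fe_le_def
proof (intro allI impI)
  fix B assume "eventually (\<lambda>n. n \<in> B) U"
  then have "\<not> eventually (\<lambda>n. n \<in> - B) V"
    using assms(3)[of "- B"] ultrafilter_eventually_Compl_iff[OF assms(1)] by blast
  then have "eventually (\<lambda>n. n \<in> B) V"
    using ultrafilter_eventually_Compl_iff[OF assms(2)] by blast
  then show "\<exists>A. eventually (\<lambda>n. n \<in> A) V \<and> fe_set A B"
    using fe_set_subset by blast
qed

lemma fe_le_oplus_one:
  assumes U: "ultrafilter U" and le: "fe_le U V"
    and C: "eventually (\<lambda>n. n \<in> C) V" "\<not> eventually (\<lambda>n. n \<in> C) U"
  shows "fe_le (oplus_one U) V"
  unfolding fe_le_def
proof (intro allI impI)
  fix B assume "eventually (\<lambda>n. n \<in> B) V"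
  with C(1) have "eventually (\<lambda>n. n \<in> B \<inter> C) V"
    by (simp add: eventually_conj_iff)
  then obtain A where A: "eventually (\<lambda>n. n \<in> A) U" "fe_set A (B \<inter> C)"
    using le unfolding fe_le_def by blast
  \<comment> \<open>Removing \<open>C\<close> stays inside \<open>U\<close>, because the complement
    of \<open>C\<close> is in \<open>U\<close>, and makes the source disjoint from the target
    \<open>B \<inter> C\<close>.\<close>
  let ?A = "A - C"
  have "eventually (\<lambda>n. n \<in> - C) U"
    using U C(2) by (simp only: ultrafilter_eventually_Compl_iff not_False_eq_True)
  with A(1) have "eventually (\<lambda>n. n \<in> ?A) U"
    by (simp add: eventually_conj_iff)
  \<comment> \<open>The preimage under the successor of the successor image of \<open>?A\<close>
    contains \<open>?A\<close>.\<close>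
  then have "eventually (\<lambda>n. n \<in> Suc ` ?A) (oplus_one U)"
    unfolding eventually_oplus_one_iff by (rule eventually_mono) simp
  moreover have "fe_set ?A (B \<inter> C)"
    using A(2) by (rule fe_set_antimono_left) blast
  then have "fe_set (Suc ` ?A) (B \<inter> C)"
    by (rule fe_set_Suc_image_if_disjoint) blast
  then have "fe_set (Suc ` ?A) B"
    by (rule fe_set_mono_right) blast
  ultimately show "\<exists>A. eventually (\<lambda>n. n \<in> A) (oplus_one U) \<and> fe_set A B"
    by blast
qed

theorem theorem12:
  fixes U V :: "nat filter"
  assumes "ultrafilter U" and "ultrafilter V"
    and "fe_le U V" and "fe_le V (oplus_one U)"
  shows "fe_equiv U V \<or> fe_equiv (oplus_one U) V"
\<comment> \<open>The split is whether \<open>V\<close> is contained in \<open>U\<close>, which for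
  ultrafilters means equality. If not, a set \<open>C\<close> separating them moves the lower bound
  of \<open>V\<close> up from \<open>U\<close> to \<open>oplus_one U\<close>, where it meets the
  upper bound.\<close>
proof (cases "\<forall>C. eventually (\<lambda>n. n \<in> C) V \<longrightarrow> eventually (\<lambda>n. n \<in> C) U")
  case True
  then have "fe_le V U"
    using assms(1,2) by (simp add: fe_le_if_sets_subset)
  then show ?thesis
    using assms(3) by (simp add: fe_equiv_def)
next
  case False
  then obtain C where "eventually (\<lambda>n. n \<in> C) V" "\<not> eventually (\<lambda>n. n \<in> C) U"
    by auto
  then have "fe_le (oplus_one U) V"
    by (rule fe_le_oplus_one[OF assms(1,3)])
  then show ?thesis
    using assms(4) by (simp add: fe_equiv_def)
qed

end
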